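(* Let $n\ge 0$ be an integer and let $a_0,\ldots,a_n$ be real numbers with $a_0\neq 0$ and $a_n\neq 0$. Let $P(\theta)=\sum_{j=0}^n a_j\cos(j\theta)$ and $Q(\theta)=\sum_{j=0}^n a_{n-j}\cos(j\theta)$. Let $Z_P$ be the number of $\theta\in[0,2\pi)$ such that $P(\theta)=0$, and let $Z_Q$ be the number of $\theta\in[0,2\pi)$ such that $Q(\theta)=0$. Then $Z_P+Z_Q\geq 2n$.
   Context: $Z_P$ and $Z_Q$ count distinct values of $\theta$ in $[0,2\pi)$, without multiplicity. *)

theory Defs
  imports Complex_Main
begin

definition cosine_poly :: "nat \<Rightarrow> (nat \<Rightarrow> real) \<Rightarrow> real \<Rightarrow> real" where
  "cosine_poly n a \<theta> = (\<Sum>j=0..n. a j * cos (real j * \<theta>))"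

definition reciprocal_cosine_poly :: "nat \<Rightarrow> (nat \<Rightarrow> real) \<Rightarrow> real \<Rightarrow> real" where
  "reciprocal_cosine_poly n a \<theta> = (\<Sum>j=0..n. a (n - j) * cos (real j * \<theta>))"

text \<open>Distinct zeros in one period, without multiplicity. For a function that has infinitely many
  zeros there, \<^term>\<open>card\<close> would give 0; this does not occur for a cosine polynomial with some
  nonzero coefficient.\<close>

definition num_zeros :: "(real \<Rightarrow> real) \<Rightarrow> nat" where
  "num_zeros f = card {\<theta>. 0 \<le> \<theta> \<and> \<theta> < 2 * pi \<and> f \<theta> = 0}"

end

theory Submission
  imports Defs "HOL-Analysis.Complex_Transcendental"
    "HOL-Computational_Algebra.Fundamental_Theorem_Algebra"
begin

text \<open>
  Put \<open>A z = (\<Sum>j\<le>n. a j * z ^ j)\<close> and write \<open>u = cis \<theta>\<close>. Then \<open>P \<theta> = Re (A u)\<close> and, as the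
  coefficients are real, \<open>Q \<theta> = Re (u ^ n * cnj (A u))\<close>. If \<open>A u = r \<theta> * cis (\<psi> \<theta>)\<close> with real \<open>r\<close> and
  continuous \<open>\<psi>\<close>, this reads \<open>P \<theta> = r \<theta> * cos (\<psi> \<theta>)\<close> and \<open>Q \<theta> = r \<theta> * cos (n * \<theta> - \<psi> \<theta>)\<close>.
  Suppose that \<open>\<psi>\<close> gains \<open>N * pi\<close> over a period, with \<open>0 \<le> N \<le> 2 * n\<close>. The other phase then gains
  \<open>(2 * n - N) * pi\<close>, and since a continuous phase that gains \<open>M * pi\<close> meets at least \<open>M\<close> odd
  multiples of \<open>pi / 2\<close> (lemma \<open>num_zeros_ge_phase_gain\<close>), there are at least \<open>N\<close> zeros of \<open>P\<close> and
  at least \<open>2 * n - N\<close> zeros of \<open>Q\<close>.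

  The phase \<open>\<psi>\<close> is the sum of the phases of the linear factors of \<open>A\<close> (lemma \<open>phase_gain_poly\<close>).
  A factor \<open>u - c\<close> gains \<open>2 * pi\<close>, \<open>pi\<close> or \<open>0\<close> according as \<open>c\<close> lies inside, on or outside the
  unit circle (lemma \<open>phase_gain_linear\<close>). Allowing \<open>r\<close> to change sign is what makes roots on the
  circle harmless: there the argument jumps by \<open>pi\<close>, and the sign of \<open>r\<close> absorbs the jump.
\<close>

section \<open>Continuous phases along the unit circle\<close>

text \<open>The amplitude \<open>r\<close> is an arbitrary real function, not a modulus: its sign changes are what lets
  the phase stay continuous across the zeros of \<open>f\<close>.\<close>

definition phase_gain :: "(real \<Rightarrow> complex) \<Rightarrow> nat \<Rightarrow> bool" where
  "phase_gain f N \<longleftrightarrow> (\<exists>r \<psi>. continuous_on {0..2*pi} \<psi> \<and> \<psi> (2*pi) = \<psi> 0 + real N * pi \<and>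
     (\<forall>\<theta>. f \<theta> = of_real (r \<theta>) * cis (\<psi> \<theta>)))"

lemma phase_gainI:
  assumes "continuous_on {0..2*pi} \<psi>" "\<psi> (2*pi) = \<psi> 0 + real N * pi"
    "\<And>\<theta>. f \<theta> = of_real (r \<theta>) * cis (\<psi> \<theta>)"
  shows "phase_gain f N"
  using assms unfolding phase_gain_def by blast

lemma phase_gain_const: "phase_gain (\<lambda>_. c) 0"
  by (rule phase_gainI[where r = "\<lambda>_. cmod c" and \<psi> = "\<lambda>_. Arg c"])
     (simp_all add: rcis_cmod_Arg flip: rcis_def)

lemma phase_gain_cis: "phase_gain cis 2"
  by (rule phase_gainI[where r = "\<lambda>_. 1" and \<psi> = "\<lambda>\<theta>. \<theta>"]) simp_all

lemma phase_gain_mult: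
  assumes "phase_gain f M" "phase_gain g N"
  shows "phase_gain (\<lambda>\<theta>. f \<theta> * g \<theta>) (M + N)"
proof -
  obtain r \<psi> where f: "continuous_on {0..2*pi} \<psi>" "\<psi> (2*pi) = \<psi> 0 + real M * pi"
    "\<And>\<theta>. f \<theta> = of_real (r \<theta>) * cis (\<psi> \<theta>)"
    using assms(1) unfolding phase_gain_def by blast
  obtain s \<phi> where g: "continuous_on {0..2*pi} \<phi>" "\<phi> (2*pi) = \<phi> 0 + real N * pi"
    "\<And>\<theta>. g \<theta> = of_real (s \<theta>) * cis (\<phi> \<theta>)"
    using assms(2) unfolding phase_gain_def by blast
  show ?thesis
    by (rule phase_gainI[where r = "\<lambda>\<theta>. r \<theta> * s \<theta>" and \<psi> = "\<lambda>\<theta>. \<psi> \<theta> + \<phi> \<theta>"])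
       (use f g in \<open>auto intro!: continuous_intros simp: distrib_left mult_ac simp flip: cis_mult\<close>)
qed

text \<open>The values stay in the disc of radius 1 about 1, where the principal argument is continuous,
  so the phase returns to its initial value.\<close>

lemma phase_gain_one_minus:
  assumes cont: "continuous_on {0..2*pi} w" and small: "\<And>\<theta>. cmod (w \<theta>) < 1"
    and per: "w (2*pi) = w 0"
  shows "phase_gain (\<lambda>\<theta>. 1 - w \<theta>) 0"
proof (rule phase_gainI[where r = "\<lambda>\<theta>. cmod (1 - w \<theta>)" and \<psi> = "\<lambda>\<theta>. Arg (1 - w \<theta>)"])
  have "1 - w \<theta> \<notin> \<real>\<^sub>\<le>\<^sub>0" for \<theta>
  proof -
    have "Re (1 - w \<theta>) > 0"
      using small[of \<theta>] complex_Re_le_cmod[of "w \<theta>"] by simp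
    then show ?thesis
      by (auto simp: complex_nonpos_Reals_iff)
  qed
  then show "continuous_on {0..2*pi} (\<lambda>\<theta>. Arg (1 - w \<theta>))"
    by (auto intro!: continuous_intros cont)
qed (simp_all add: per rcis_cmod_Arg flip: rcis_def)

text \<open>Inside the circle, \<open>cis \<theta>\<close> dominates and is factored out; outside, \<open>c\<close> dominates. On the
  circle, \<open>cis \<theta> - cis \<alpha>\<close> is a chord: its direction turns at half the speed of \<open>\<theta>\<close>, and its signed
  length is \<open>2 * sin ((\<theta> - \<alpha>) / 2)\<close>.\<close>

lemma phase_gain_linear:
  "\<exists>N\<le>2. phase_gain (\<lambda>\<theta>. cis \<theta> - c) N"
proof -
  consider "cmod c < 1" | "cmod c = 1" | "cmod c > 1"
    by linarith
  then show ?thesis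
  proof cases
    case 1
    have "phase_gain (\<lambda>\<theta>. 1 - c * cis (- \<theta>)) 0"
      by (rule phase_gain_one_minus)
         (use 1 in \<open>auto intro!: continuous_intros simp: norm_mult simp flip: cis_cnj\<close>)
    from phase_gain_mult[OF phase_gain_cis this]
    have "phase_gain (\<lambda>\<theta>. cis \<theta> - c) 2"
      by (simp add: right_diff_distrib mult.left_commute cis_mult)
    then show ?thesis by blast
  next
    case 2
    define \<alpha> where "\<alpha> = Arg c"
    have c: "c = cis \<alpha>"
      using 2 rcis_cmod_Arg[of c] by (simp add: \<alpha>_def rcis_def)
    have "cis \<theta> - c = of_real (2 * sin ((\<theta> - \<alpha>) / 2)) * cis ((\<theta> + \<alpha> + pi) / 2)" for \<theta>
    proof -
      let ?s = "(\<theta> + \<alpha>) / 2" and ?d = "(\<theta> - \<alpha>) / 2"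
      have diff: "cis x - cis (- x) = 2 * \<i> * of_real (sin x)" for x
        by (simp add: complex_eq_iff)
      have "?s + ?d = \<theta>" "?s + - ?d = \<alpha>"
        by (simp_all add: field_simps)
      then have "cis \<theta> - c = cis ?s * cis ?d - cis ?s * cis (- ?d)"
        unfolding c cis_mult by simp
      also have "\<dots> = cis ?s * (cis ?d - cis (- ?d))"
        by (rule right_diff_distrib[symmetric])
      also have "cis ?d - cis (- ?d) = 2 * \<i> * of_real (sin ?d)"
        by (rule diff)
      also have "cis ?s * (2 * \<i> * of_real (sin ?d)) = of_real (2 * sin ?d) * (cis ?s * \<i>)"
        by (simp only: of_real_mult of_real_numeral mult_ac)
      also have "cis ?s * \<i> = cis ((\<theta> + \<alpha> + pi) / 2)"
        unfolding cis_pi_half[symmetric] cis_mult add_divide_distrib ..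
      finally show ?thesis .
    qed
    moreover have "continuous_on {0..2*pi} (\<lambda>\<theta>. (\<theta> + \<alpha> + pi) / 2)"
      by (intro continuous_intros) simp
    moreover have "(2 * pi + \<alpha> + pi) / 2 = (0 + \<alpha> + pi) / 2 + real 1 * pi"
      by (simp add: field_simps)
    ultimately have "phase_gain (\<lambda>\<theta>. cis \<theta> - c) 1"
      by (intro phase_gainI[where r = "\<lambda>\<theta>. 2 * sin ((\<theta> - \<alpha>) / 2)"
            and \<psi> = "\<lambda>\<theta>. (\<theta> + \<alpha> + pi) / 2"])
    then show ?thesis
      by (intro exI[of _ 1]) simp
  next
    case 3
    then have nz: "c \<noteq> 0"
      by auto
    have "phase_gain (\<lambda>\<theta>. 1 - cis \<theta> / c) 0"
      by (rule phase_gain_one_minus) (use 3 nz in \<open>auto intro!: continuous_intros simp: norm_divide\<close>)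
    from phase_gain_mult[OF phase_gain_const[of "- c"] this]
    have "phase_gain (\<lambda>\<theta>. cis \<theta> - c) 0"
      using nz by (simp add: algebra_simps)
    then show ?thesis by blast
  qed
qed

lemma phase_gain_poly:
  fixes p :: "complex poly"
  shows "\<exists>N\<le>2 * degree p. phase_gain (\<lambda>\<theta>. poly p (cis \<theta>)) N"
proof -
  obtain root where root: "smult (lead_coeff p) (\<Prod>i<degree p. [:- root i, 1:]) = p"
    by (rule complex_poly_decompose')
  have "\<exists>N\<le>2 * k. phase_gain (\<lambda>\<theta>. lead_coeff p * (\<Prod>i<k. cis \<theta> - root i)) N" for k
  proof (induction k)
    case 0
    show ?case
      using phase_gain_const by simp
  next
    case (Suc k)
    then obtain M where "M \<le> 2 * k"
      "phase_gain (\<lambda>\<theta>. lead_coeff p * (\<Prod>i<k. cis \<theta> - root i)) M"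
      by blast
    moreover obtain N where "N \<le> 2" "phase_gain (\<lambda>\<theta>. cis \<theta> - root k) N"
      using phase_gain_linear by blast
    ultimately show ?case
      using phase_gain_mult[of "\<lambda>\<theta>. lead_coeff p * (\<Prod>i<k. cis \<theta> - root i)" M
          "\<lambda>\<theta>. cis \<theta> - root k" N]
      by (intro exI[of _ "M + N"]) (simp add: mult.assoc)
  qed
  moreover have "poly p z = lead_coeff p * (\<Prod>i<degree p. z - root i)" for z
    by (subst root[symmetric]) (simp add: poly_prod)
  ultimately show ?thesis
    by simp
qed

section \<open>Zeros forced by the gain of a phase\<close>

lemma num_zeros_ge_phase_gain:
  assumes cont: "continuous_on {0..2*pi} \<psi>" and gain: "\<psi> (2*pi) = \<psi> 0 + real N * pi"
    and fin: "finite {\<theta>. 0 \<le> \<theta> \<and> \<theta> < 2 * pi \<and> f \<theta> = 0}"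
    and zero: "\<And>\<theta>. cos (\<psi> \<theta>) = 0 \<Longrightarrow> f \<theta> = 0"
  shows "N \<le> num_zeros f"
proof -
  define k where "k = \<lceil>\<psi> 0 / pi - 1 / 2\<rceil>"
  \<comment> \<open>The \<open>N\<close> zeros of the cosine in the half-open interval from \<open>\<psi> 0\<close> to \<open>\<psi> (2*pi)\<close>. As the right
    end is excluded, so is the preimage \<open>2*pi\<close>, and no zero is counted twice in the period.\<close>
  define v where "v i = (real_of_int k + real i + 1 / 2) * pi" for i :: nat
  have k: "\<psi> 0 / pi - 1 / 2 \<le> of_int k" "of_int k < \<psi> 0 / pi - 1 / 2 + 1"
    unfolding k_def by linarith+
  have cos_v: "cos (v i) = 0" for i
    unfolding cos_zero_iff_int v_def
    by (rule exI[of _ "2 * (k + int i) + 1"]) (simp add: field_simps)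
  have "\<exists>\<theta>. 0 \<le> \<theta> \<and> \<theta> < 2 * pi \<and> \<psi> \<theta> = v i" if "i < N" for i
  proof -
    have "\<psi> 0 / pi \<le> of_int k + real i + 1 / 2"
      using k(1) by simp
    then have low: "\<psi> 0 \<le> v i"
      by (simp add: v_def field_simps)
    have "of_int k + real i + 1 / 2 < \<psi> 0 / pi + real N"
      using k(2) that by linarith
    then have "v i < (\<psi> 0 / pi + real N) * pi"
      unfolding v_def by (rule mult_strict_right_mono) simp
    then have high: "v i < \<psi> (2*pi)"
      by (simp add: gain distrib_right)
    obtain \<theta> where "0 \<le> \<theta>" "\<theta> \<le> 2 * pi" "\<psi> \<theta> = v i"
      using IVT'[of \<psi> 0 "v i" "2*pi"] low high cont by auto
    moreover from this high have "\<theta> \<noteq> 2 * pi"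
      by auto
    ultimately show ?thesis
      by force
  qed
  then obtain t where t: "\<And>i. i < N \<Longrightarrow> 0 \<le> t i \<and> t i < 2 * pi \<and> \<psi> (t i) = v i"
    by metis
  have "inj_on t {..<N}"
  proof (rule inj_onI)
    fix i j assume "i \<in> {..<N}" "j \<in> {..<N}" "t i = t j"
    then have "v i = v j"
      using t[of i] t[of j] by simp
    then show "i = j"
      by (simp add: v_def)
  qed
  moreover have "t ` {..<N} \<subseteq> {\<theta>. 0 \<le> \<theta> \<and> \<theta> < 2 * pi \<and> f \<theta> = 0}"
    using t cos_v by (auto intro!: zero)
  ultimately have "card {..<N} \<le> card {\<theta>. 0 \<le> \<theta> \<and> \<theta> < 2 * pi \<and> f \<theta> = 0}"
    using fin by (rule card_inj_on_le)
  then show ?thesis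
    by (simp add: num_zeros_def)
qed

section \<open>Finiteness of the zero set\<close>

lemma inj_on_cis: "inj_on cis {0..<2*pi}"
proof (rule inj_onI)
  fix x y :: real
  assume x: "x \<in> {0..<2*pi}" and y: "y \<in> {0..<2*pi}" and eq: "cis x = cis y"
  have "sin x = sin y \<and> cos x = cos y"
    using eq by (simp add: complex_eq_iff)
  then obtain m :: int where m: "x = y + 2 * pi * m"
    unfolding sin_cos_eq_iff by blast
  have "2 * pi * real_of_int m < 2 * pi * 1" "2 * pi * (-1) < 2 * pi * real_of_int m"
    using x y m unfolding atLeastLessThan_iff by linarith+
  then have "real_of_int m < 1" "-1 < real_of_int m"
    by (simp_all only: mult_less_cancel_left_pos[of "2 * pi"] pi_gt_zero
        zero_less_mult_iff zero_less_numeral simp_thms)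
  then show "x = y"
    using m by simp
qed

text \<open>Multiplication by \<open>2 * cis \<theta> ^ n\<close> turns the cosine polynomial into a polynomial in \<open>cis \<theta>\<close>;
  its coefficient of degree \<open>2 * n\<close> is \<open>a n\<close> (or \<open>2 * a 0\<close>, for \<open>n = 0\<close>).\<close>

lemma finite_zeros_cosine_poly:
  assumes "a n \<noteq> 0"
  shows "finite {\<theta>. 0 \<le> \<theta> \<and> \<theta> < 2 * pi \<and> cosine_poly n a \<theta> = 0}"
proof -
  define p :: "complex poly" where
    "p = (\<Sum>j=0..n. monom (of_real (a j)) (n + j) + monom (of_real (a j)) (n - j))"
  have "coeff p (2 * n) = (\<Sum>j=0..n. if j = n then if n = 0 then 2 * of_real (a n) else of_real (a n) else 0)"
    unfolding p_def coeff_sum by (rule sum.cong) (auto simp: coeff_monom)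
  also have "\<dots> \<noteq> 0"
    using assms by (cases "n = 0") simp_all
  finally have "p \<noteq> 0"
    by auto
  have "poly p (cis \<theta>) = 2 * cis \<theta> ^ n * of_real (cosine_poly n a \<theta>)" for \<theta>
  proof -
    have "of_real x * cis \<theta> ^ (n + j) + of_real x * cis \<theta> ^ (n - j) =
        2 * cis \<theta> ^ n * of_real (x * cos (real j * \<theta>))" if "j \<le> n" for x j
    proof -
      have "cis \<theta> ^ (n + j) = cis \<theta> ^ n * cis (real j * \<theta>)"
        by (simp add: power_add Complex.DeMoivre)
      moreover have "cis \<theta> ^ (n - j) = cis \<theta> ^ n * cis (- (real j * \<theta>))"
        using that by (simp add: Complex.DeMoivre cis_mult of_nat_diff algebra_simps)
      moreover have "cis y + cis (- y) = 2 * of_real (cos y)" for y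
        by (simp add: complex_eq_iff)
      ultimately show ?thesis
        by (simp add: mult_ac flip: distrib_left)
    qed
    then show ?thesis
      by (simp add: p_def poly_sum poly_monom cosine_poly_def sum_distrib_left)
  qed
  then have "cis ` {\<theta>. 0 \<le> \<theta> \<and> \<theta> < 2 * pi \<and> cosine_poly n a \<theta> = 0} \<subseteq> {z. poly p z = 0}"
    by auto
  then have "finite (cis ` {\<theta>. 0 \<le> \<theta> \<and> \<theta> < 2 * pi \<and> cosine_poly n a \<theta> = 0})"
    using poly_roots_finite[OF \<open>p \<noteq> 0\<close>] by (rule finite_subset)
  then show ?thesis
    by (rule finite_imageD) (rule inj_on_subset[OF inj_on_cis], auto)
qed

section \<open>The sum of the two zero counts\<close>

lemma reciprocal_cosine_poly_eq: "reciprocal_cosine_poly n a = cosine_poly n (\<lambda>j. a (n - j))"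
  by (simp add: fun_eq_iff reciprocal_cosine_poly_def cosine_poly_def)

theorem mainTheorem2:
  fixes n :: nat and a :: "nat \<Rightarrow> real"
  assumes "a 0 \<noteq> 0" and "a n \<noteq> 0"
  shows "num_zeros (cosine_poly n a) + num_zeros (reciprocal_cosine_poly n a) \<ge> 2 * n"
proof -
  define A :: "complex poly" where "A = (\<Sum>j=0..n. monom (of_real (a j)) j)"
  have "degree A \<le> n"
    unfolding A_def by (rule degree_sum_le) (auto intro: order_trans[OF degree_monom_le])
  then obtain N where N: "N \<le> 2 * n" "phase_gain (\<lambda>\<theta>. poly A (cis \<theta>)) N"
    using phase_gain_poly[of A] by (meson order_trans mult_le_mono2)
  then obtain r \<psi> where cont: "continuous_on {0..2*pi} \<psi>" and gain: "\<psi> (2*pi) = \<psi> 0 + real N * pi"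
    and polar: "\<And>\<theta>. poly A (cis \<theta>) = of_real (r \<theta>) * cis (\<psi> \<theta>)"
    unfolding phase_gain_def by blast
  have A_cis: "poly A (cis \<theta>) = (\<Sum>j=0..n. of_real (a j) * cis (real j * \<theta>))" for \<theta>
    by (simp add: A_def poly_sum poly_monom Complex.DeMoivre)
  have P: "cosine_poly n a \<theta> = r \<theta> * cos (\<psi> \<theta>)" for \<theta>
  proof -
    have "cosine_poly n a \<theta> = Re (poly A (cis \<theta>))"
      by (simp add: A_cis cosine_poly_def)
    then show ?thesis
      by (simp add: polar)
  qed
  have Q: "reciprocal_cosine_poly n a \<theta> = r \<theta> * cos (real n * \<theta> - \<psi> \<theta>)" for \<theta>
  proof -
    have "cis (real n * \<theta>) * cnj (poly A (cis \<theta>))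
        = (\<Sum>j=0..n. of_real (a j) * cis (real (n - j) * \<theta>))"
      unfolding A_cis cnj_sum sum_distrib_left
      by (rule sum.cong) (auto simp: cis_cnj cis_mult of_nat_diff algebra_simps)
    also have "\<dots> = (\<Sum>j=0..n. of_real (a (n - j)) * cis (real j * \<theta>))"
      by (rule sum.reindex_bij_witness[of _ "\<lambda>j. n - j" "\<lambda>j. n - j"]) auto
    finally have "reciprocal_cosine_poly n a \<theta> = Re (cis (real n * \<theta>) * cnj (poly A (cis \<theta>)))"
      by (simp add: reciprocal_cosine_poly_def)
    also have "cis (real n * \<theta>) * cnj (poly A (cis \<theta>)) = of_real (r \<theta>) * cis (real n * \<theta> - \<psi> \<theta>)"
      by (simp add: polar cis_cnj cis_mult mult.left_commute)
    finally show ?thesis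
      by simp
  qed
  have "N \<le> num_zeros (cosine_poly n a)"
    using cont gain finite_zeros_cosine_poly[where a = a, OF assms(2)]
    by (rule num_zeros_ge_phase_gain) (simp add: P)
  moreover have "2 * n - N \<le> num_zeros (reciprocal_cosine_poly n a)"
  proof (rule num_zeros_ge_phase_gain[where \<psi> = "\<lambda>\<theta>. real n * \<theta> - \<psi> \<theta>"])
    show "continuous_on {0..2*pi} (\<lambda>\<theta>. real n * \<theta> - \<psi> \<theta>)"
      by (intro continuous_intros cont)
    show "real n * (2*pi) - \<psi> (2*pi) = real n * 0 - \<psi> 0 + real (2 * n - N) * pi"
      using N(1) unfolding gain by (simp add: of_nat_diff algebra_simps)
    show "finite {\<theta>. 0 \<le> \<theta> \<and> \<theta> < 2 * pi \<and> reciprocal_cosine_poly n a \<theta> = 0}"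
      unfolding reciprocal_cosine_poly_eq by (rule finite_zeros_cosine_poly) (simp add: assms(1))
  qed (simp add: Q)
  ultimately show ?thesis
    by linarith
qed

end
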